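(* Let $n\ge1$, $\delta>0$, $\beta<n+4$, $s\in\mathbb{R}$ and $b\in H^s(T^n)$. For $t\ge0$ set $$U(t)=\hat b_0t+\sum_{0\ne k\in\mathbb{Z}^n}\frac{e^{m(\nu_k)t}-1}{m(\nu_k)}\hat b_k e^{i\nu_k\cdot x},\qquad V(t)=\sum_{k\in\mathbb{Z}^n}e^{m(\nu_k)t}\hat b_k e^{i\nu_k\cdot x}.$$ Then, for all $t\in(0,\infty)$, $\frac{dU}{dt}=V(t)$. Moreover, for every integer $N\ge1$, $$\frac{d^NU}{dt^N}=\sum_{k\in\mathbb{Z}^n}\hat b_k\,m(\nu_k)^{N-1}e^{m(\nu_k)t}e^{i\nu_k\cdot x}$$ for all $t\in(0,\infty)$, where the differentiation is in the sense of Gateaux differentiation.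
   Context: Let $r_1,\dots,r_n>0$ and let $T^n=\prod_{i=1}^n[0,r_i]$ be the periodic torus (opposite faces identified). For $k\in\mathbb{Z}^n$ put $\nu_k=\left(\frac{2\pi k_1}{r_1},\dots,\frac{2\pi k_n}{r_n}\right)$. A periodic distribution $h$ on $T^n$ is written through its Fourier coefficients as $h=\sum_{k\in\mathbb{Z}^n}\hat h_k e^{i\nu_k\cdot x}$. For $s\in\mathbb{R}$, $H^s(T^n)$ is the space of periodic distributions with $\|h\|_{H^s(T^n)}^2:=\sum_{k\in\mathbb{Z}^n}(1+\|k\|^2)^s|\hat h_k|^2<\infty$. For $n\ge1$, $\delta>0$, $\beta<n+4$, the Fourier multiplier is $$m(\nu)=m^{\delta,\beta}(\nu)=-\|\nu\|^2\;{}_2F_3\!\left(1,\tfrac{n+2-\beta}{2};\,2,\tfrac{n+2}{2},\tfrac{n+4-\beta}{2};\,-\tfrac14\|\nu\|^2\delta^2\right),\quad \nu\in\mathbb{R}^n.$$ For $\beta<n+2$ it equals $c^{\delta,\beta}\int_{B_\delta(0)}\frac{\cos(\nu\cdot z)-1}{\|z\|^\beta}dz$ with $c^{\delta,\beta}=\frac{2(n+2-\beta)\Gamma(\frac n2+1)}{\pi^{n/2}\delta^{n+2-\beta}}$; for $\beta=n+2$ it equals $-\|\nu\|^2$. The convention $0^0=1$ is used (for $k=0$, $N=1$). Gateaux differentiation: $\frac{d}{dt}W(t)=Z(t)$ means $\lim_{h\to0}\left\|\frac1h[W(t+h)-W(t)]-Z(t)\right\|_{H^q(T^n)}=0$, where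 $q=s$ when $\beta\le n$, and $q\in\mathbb{R}$ is arbitrary (every $q$) when $n<\beta<n+4$ (only the difference inside the norm, not $W(t)$ itself, is required to lie in $H^q(T^n)$). *)

theory Defs
  imports "HOL-Analysis.Analysis"
begin

text \<open>The generalized hypergeometric function \<open>pFq\<close> with upper parameters \<open>as\<close> and lower
  parameters \<open>bs\<close>.\<close>

definition hypergeometric :: "real list \<Rightarrow> real list \<Rightarrow> real \<Rightarrow> real" where
  "hypergeometric as bs z =
     (\<Sum>j. (\<Prod>a\<leftarrow>as. pochhammer a j) / (\<Prod>b\<leftarrow>bs. pochhammer b j) * z ^ j / fact j)"

definition multiplier :: "real \<Rightarrow> real \<Rightarrow> real ^ 'n \<Rightarrow> real" where
  "multiplier \<delta> \<beta> \<nu> =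
     - ((norm \<nu>)\<^sup>2) *
       hypergeometric [1, (real CARD('n) + 2 - \<beta>) / 2]
                      [2, (real CARD('n) + 2) / 2, (real CARD('n) + 4 - \<beta>) / 2]
                      (- (1 / 4) * (norm \<nu>)\<^sup>2 * \<delta>\<^sup>2)"

definition frequency :: "real ^ 'n \<Rightarrow> int ^ 'n \<Rightarrow> real ^ 'n" where
  "frequency r k = (\<chi> i. 2 * pi * real_of_int (k $ i) / r $ i)"

definition lattice_norm :: "int ^ 'n \<Rightarrow> real" where
  "lattice_norm k = norm (\<chi> i. real_of_int (k $ i))"

text \<open>A periodic distribution is identified with its family of Fourier coefficients: \<open>h\<close> stands for
  the series with terms \<open>h k * exp (\<i> * (frequency r k \<bullet> x))\<close>. The series converges in the sense of
  distributions iff the coefficients grow at most polynomially.\<close>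

type_synonym 'n fourier_coeffs = "int ^ 'n \<Rightarrow> complex"

definition periodic_distributions :: "('n::finite) fourier_coeffs set" where
  "periodic_distributions =
     {h. \<exists>C M. \<forall>k. norm (h k) \<le> C * (1 + (lattice_norm k)\<^sup>2) powr M}"

definition sobolev_space :: "real \<Rightarrow> ('n::finite) fourier_coeffs set" where
  "sobolev_space s =
     {h \<in> periodic_distributions.
        (\<lambda>k. (1 + (lattice_norm k)\<^sup>2) powr s * (norm (h k))\<^sup>2) summable_on UNIV}"

text \<open>Only meaningful on \<open>sobolev_space s\<close>: elsewhere \<open>infsum\<close> takes its default value \<open>0\<close>.\<close>

definition sobolev_norm :: "real \<Rightarrow> ('n::finite) fourier_coeffs \<Rightarrow> real" where
  "sobolev_norm s h =
     sqrt (\<Sum>\<^sub>\<infinity>k. (1 + (lattice_norm k)\<^sup>2) powr s * (norm (h k))\<^sup>2)"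

text \<open>\<open>W\<close> is distribution-valued near \<open>t\<close>; only the error of the difference quotient, and not
  \<open>W t\<close> itself, has to belong to \<open>sobolev_space q\<close>. That membership is stated separately because
  convergence of \<open>sobolev_norm\<close> alone would not imply it.\<close>

definition gateaux_error ::
  "(real \<Rightarrow> ('n::finite) fourier_coeffs) \<Rightarrow> 'n fourier_coeffs \<Rightarrow> real \<Rightarrow> real \<Rightarrow> 'n fourier_coeffs" where
  "gateaux_error W Z t h = (\<lambda>k. of_real (1 / h) * (W (t + h) k - W t k) - Z k)"

definition has_gateaux_derivative ::
  "real \<Rightarrow> (real \<Rightarrow> ('n::finite) fourier_coeffs) \<Rightarrow> 'n fourier_coeffs \<Rightarrow> real \<Rightarrow> bool" where
  "has_gateaux_derivative q W Z t \<longleftrightarrow>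
     (\<forall>\<^sub>F \<tau> in nhds t. W \<tau> \<in> periodic_distributions) \<and> Z \<in> periodic_distributions \<and>
     (\<forall>\<^sub>F h in at 0. gateaux_error W Z t h \<in> sobolev_space q) \<and>
     ((\<lambda>h. sobolev_norm q (gateaux_error W Z t h)) \<longlongrightarrow> 0) (at 0)"

text \<open>\<open>Z\<close> is the \<open>N\<close>-th derivative of \<open>W\<close> on the open half-line \<open>{0<..}\<close>.\<close>

primrec has_nth_gateaux_derivative ::
  "real \<Rightarrow> nat \<Rightarrow> (real \<Rightarrow> ('n::finite) fourier_coeffs) \<Rightarrow> (real \<Rightarrow> 'n fourier_coeffs) \<Rightarrow> bool" where
  "has_nth_gateaux_derivative q 0 W Z \<longleftrightarrow> (\<forall>t>0. Z t = W t)"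
| "has_nth_gateaux_derivative q (Suc N) W Z \<longleftrightarrow>
     (\<exists>Y. has_nth_gateaux_derivative q N W Y \<and>
          (\<forall>t>0. has_gateaux_derivative q Y (Z t) t))"

end

theory Submission
  imports Defs
begin

text \<open>On each Fourier mode the claim is the differentiation of \<open>exp (m k * t)\<close>, and the error of
  the difference quotient is at most \<open>\<bar>h\<bar> * \<bar>m k\<bar> ^ p * exp (m k * t / 2) * norm (b k)\<close>.
  Hence it suffices that \<open>m k < 0\<close> for \<open>k \<noteq> 0\<close>, which bounds \<open>\<bar>m k\<bar> ^ p * exp (m k * t / 2)\<close>,
  and, when \<open>\<beta> > n\<close>, that \<open>- m k\<close> grows at least like a power of the norm of \<open>k\<close>, which makes
  the exponential beat every Sobolev weight.

  Write \<open>m = - (norm \<nu>)\<^sup>2 * F y\<close> with \<open>y = (norm \<nu> * \<delta> / 2)\<^sup>2\<close> and \<open>a = (n + 2 - \<beta>) / 2 > - 1\<close>.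
  Then \<open>y powr a * F y\<close> has derivative \<open>a * y powr (a - 1) * G y\<close>, where
  \<open>y * G y = n / 2 * (1 - L (- y))\<close> and \<open>L = 0F1(n / 2; _)\<close>, a Bessel function in disguise.
  The energy \<open>L\<^sup>2 - z * L'\<^sup>2\<close> is nondecreasing in \<open>z\<close>, so \<open>\<bar>L\<bar> \<le> 1\<close> on \<open>z \<le> 0\<close>, whence
  \<open>0 \<le> G \<le> 1\<close>. For \<open>a > 0\<close> this makes \<open>y powr a * F y\<close> nondecreasing, so \<open>F > 0\<close> and
  \<open>F\<close> decays no faster than \<open>y powr (- a)\<close>; for \<open>a \<le> 0\<close> it gives \<open>F \<ge> 1\<close>.\<close>

section \<open>The hypergeometric function\<close>

text \<open>This is 0F1(c; z). For x > 0 its value at - x^2 / 4 is Gamma(c) * (x / 2)^(1 - c) times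
  the Bessel function of order c - 1.\<close>

definition confluent_limit :: "real \<Rightarrow> real \<Rightarrow> real" where
  "confluent_limit c z = (\<Sum>j. inverse (fact j * pochhammer c j) * z ^ j)"

text \<open>All factors of \<open>pochhammer c j\<close> after the first are at least 1, and the
  summand 1 covers \<open>j = 0\<close>. A bound free of \<open>j\<close> lets the factorial alone
  force convergence.\<close>

lemma inverse_pochhammer_le:
  fixes c :: real
  assumes "c > 0"
  shows "inverse (pochhammer c j) \<le> 1 + inverse c"
proof -
  have "pochhammer c (Suc i) \<ge> c" for i
  proof (induction i)
    case (Suc i)
    have "c * 1 \<le> pochhammer c (Suc i) * (c + of_nat (Suc i))"
      using Suc assms by (intro mult_mono) auto
    then show ?case
      by (metis mult.right_neutral pochhammer_Suc)
  qed simp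
  then have "inverse (pochhammer c (Suc i)) \<le> inverse c" for i
    using assms by (simp add: le_imp_inverse_le)
  then show ?thesis
    using assms by (cases j) (auto intro: add_increasing)
qed

lemma summable_confluent_limit:
  fixes c z :: real
  assumes "c > 0"
  shows "summable (\<lambda>j. inverse (fact j * pochhammer c j) * \<bar>z\<bar> ^ j)"
proof (rule summable_comparison_test')
  show "summable (\<lambda>j. (1 + inverse c) * (inverse (fact j) * \<bar>z\<bar> ^ j))"
    by (intro summable_mult summable_exp)
  show "norm (inverse (fact j * pochhammer c j) * \<bar>z\<bar> ^ j)
      \<le> (1 + inverse c) * (inverse (fact j) * \<bar>z\<bar> ^ j)" for j
  proof -
    have "inverse (fact j) * \<bar>z\<bar> ^ j * inverse (pochhammer c j)
        \<le> inverse (fact j) * \<bar>z\<bar> ^ j * (1 + inverse c)"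
      by (intro mult_left_mono inverse_pochhammer_le assms) auto
    then show ?thesis
      using pochhammer_pos[OF assms, of j] by (simp add: abs_mult mult_ac)
  qed
qed

lemma summable_dominated_by_confluent_limit:
  fixes d :: "nat \<Rightarrow> real" and c z :: real
  assumes "c > 0" "\<And>j. \<bar>d j\<bar> \<le> K * inverse (fact j * pochhammer c j)"
  shows "summable (\<lambda>j. d j * z ^ j)"
proof (rule summable_comparison_test')
  show "summable (\<lambda>j. K * (inverse (fact j * pochhammer c j) * \<bar>z\<bar> ^ j))"
    by (intro summable_mult summable_confluent_limit assms)
  show "norm (d j * z ^ j) \<le> K * (inverse (fact j * pochhammer c j) * \<bar>z\<bar> ^ j)" for j
    using mult_right_mono[OF assms(2)[of j], of "\<bar>z\<bar> ^ j"]
    by (simp add: abs_mult power_abs mult_ac)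
qed

lemma summable_confluent_limit':
  fixes c z :: real
  assumes "c > 0"
  shows "summable (\<lambda>j. inverse (fact j * pochhammer c j) * z ^ j)"
  using assms pochhammer_pos[OF assms]
  by (intro summable_dominated_by_confluent_limit[of c _ 1]) (auto simp: abs_mult less_imp_le)

lemma confluent_limit_0 [simp]: "confluent_limit c 0 = 1"
  by (simp add: confluent_limit_def)

lemma has_field_derivative_confluent_limit:
  assumes "c > 0"
  shows "(confluent_limit c has_field_derivative confluent_limit (c + 1) z / c) (at z)"
proof -
  have "((\<lambda>z. \<Sum>j. inverse (fact j * pochhammer c j) * z ^ j) has_field_derivative
      (\<Sum>j. diffs (\<lambda>j. inverse (fact j * pochhammer c j)) j * z ^ j)) (at z)"
    by (rule termdiffs_strong_converges_everywhere) (rule summable_confluent_limit'[OF assms])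
  moreover have "diffs (\<lambda>j. inverse (fact j * pochhammer c j)) j
      = inverse (fact j * pochhammer (c + 1) j) / c" for j
    using assms by (simp add: diffs_def pochhammer_rec divide_simps del: of_nat_Suc)
  ultimately show ?thesis
    using suminf_divide[OF summable_confluent_limit'[of "c + 1" z], of c] assms
    by (simp add: confluent_limit_def[abs_def] mult.commute)
qed

text \<open>This is the differential equation z L'' + c L' = L, with the derivatives expressed
  through shifted parameters. It holds coefficient by coefficient; the factor \<open>z\<close>
  shifts the index, so the constant terms are split off first.\<close>

lemma confluent_limit_contiguous:
  assumes "c > 0"
  shows "z / (c * (c + 1)) * confluent_limit (c + 2) z + confluent_limit (c + 1) z
    = confluent_limit c z"
proof -
  let ?d = "\<lambda>c j. inverse (fact j * pochhammer c j)"
  have coeff: "1 / (c * (c + 1)) * ?d (c + 2) j + ?d (c + 1) (Suc j) = ?d c (Suc j)" for j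
  proof -
    define P where "P = pochhammer (c + 2) j"
    have P: "P > 0"
      unfolding P_def using assms by (intro pochhammer_pos) simp
    have *: "pochhammer (c + 1) (Suc j) = (c + 1) * P"
      by (simp add: P_def pochhammer_rec add.assoc)
    have "pochhammer (c + 1) (Suc j) = pochhammer (c + 1) j * (c + 1 + real j)"
      by (simp add: pochhammer_Suc)
    then have **: "pochhammer c (Suc j) = c * ((c + 1) * P / (c + 1 + real j))"
      using assms * by (simp add: pochhammer_rec field_simps)
    show ?thesis
      unfolding * ** P_def[symmetric] using assms P
      by (simp add: divide_simps)
  qed
  have S: "summable (\<lambda>j. ?d c j * z ^ j)" if "c > 0" for c
    using that by (rule summable_confluent_limit')
  have split: "confluent_limit c z = 1 + (\<Sum>j. ?d c (Suc j) * z ^ Suc j)" if "c > 0" for c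
    unfolding confluent_limit_def using suminf_split_initial_segment[OF S[OF that], of 1] by simp
  have "(\<lambda>j. z / (c * (c + 1)) * (?d (c + 2) j * z ^ j) + ?d (c + 1) (Suc j) * z ^ Suc j) sums
      (z / (c * (c + 1)) * confluent_limit (c + 2) z + (confluent_limit (c + 1) z - 1))"
  proof (intro sums_add sums_mult)
    show "(\<lambda>j. ?d (c + 2) j * z ^ j) sums confluent_limit (c + 2) z"
      unfolding confluent_limit_def using assms by (intro summable_sums S) simp
    show "(\<lambda>j. ?d (c + 1) (Suc j) * z ^ Suc j) sums (confluent_limit (c + 1) z - 1)"
      using split[of "c + 1"] summable_Suc_iff[THEN iffD2, OF S[of "c + 1"]] assms
      by (simp add: summable_sums del: power_Suc fact_Suc)
  qed
  moreover have "z / (c * (c + 1)) * (?d (c + 2) j * z ^ j) + ?d (c + 1) (Suc j) * z ^ Suc j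
      = ?d c (Suc j) * z ^ Suc j" for j
    unfolding coeff[of j, symmetric] by (simp add: algebra_simps)
  ultimately show ?thesis
    using split[OF assms] sums_unique by fastforce
qed

text \<open>The energy \<open>(L z)\<^sup>2 - z * (L1 z)\<^sup>2\<close> equals 1 at 0. By the
  differential equation its derivative is \<open>(2 * c - 1) * (L1 z)\<^sup>2\<close>, which is
  where \<open>c \<ge> 1 / 2\<close> enters. For \<open>z \<le> 0\<close> the energy dominates
  \<open>(L z)\<^sup>2\<close>.\<close>

lemma confluent_limit_abs_le_1:
  assumes "c \<ge> 1 / 2" "z \<le> 0"
  shows "\<bar>confluent_limit c z\<bar> \<le> 1"
proof -
  define L L1 L2 where "L = confluent_limit c" and "L1 = (\<lambda>z. confluent_limit (c + 1) z / c)"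
    and "L2 = (\<lambda>z. confluent_limit (c + 2) z / (c * (c + 1)))"
  have L1: "(L has_field_derivative L1 z) (at z)" for z
    unfolding L_def L1_def using assms by (intro has_field_derivative_confluent_limit) simp
  have L2: "(L1 has_field_derivative L2 z) (at z)" for z
    unfolding L1_def L2_def using assms has_field_derivative_confluent_limit[of "c + 1" z]
    by (auto intro!: derivative_eq_intros simp: add.assoc divide_simps)
  have ode: "z * L2 z = L z - c * L1 z" for z
    using confluent_limit_contiguous[of c z] assms by (simp add: L_def L1_def L2_def field_simps)
  have "(L z)\<^sup>2 - z * (L1 z)\<^sup>2 \<le> (L 0)\<^sup>2 - 0 * (L1 0)\<^sup>2"
  proof (rule DERIV_nonneg_imp_nondecreasing[OF assms(2)], intro exI conjI)
    fix x assume "z \<le> x" "x \<le> 0"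
    have "((\<lambda>z. (L z)\<^sup>2 - z * (L1 z)\<^sup>2) has_real_derivative
        2 * L x * L1 x - ((L1 x)\<^sup>2 + 2 * L1 x * (x * L2 x))) (at x)"
      by (auto intro!: derivative_eq_intros L1 L2 simp: power2_eq_square algebra_simps)
    also have "2 * L x * L1 x - ((L1 x)\<^sup>2 + 2 * L1 x * (x * L2 x)) = (2 * c - 1) * (L1 x)\<^sup>2"
      unfolding ode by (simp add: power2_eq_square algebra_simps)
    finally show "((\<lambda>z. (L z)\<^sup>2 - z * (L1 z)\<^sup>2) has_real_derivative
        (2 * c - 1) * (L1 x)\<^sup>2) (at x)" .
    show "0 \<le> (2 * c - 1) * (L1 x)\<^sup>2"
      using assms by simp
  qed
  then have "(L z)\<^sup>2 \<le> 1 + z * (L1 z)\<^sup>2"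
    by (simp add: L_def)
  also have "\<dots> \<le> 1"
    using assms(2) by (simp add: mult_nonpos_nonneg)
  finally show ?thesis
    by (simp add: L_def abs_square_le_1)
qed

text \<open>The lower bound is L <= 1. The upper one is the mean value inequality, since L' is 0F1
  with parameter \<open>c + 1\<close> divided by \<open>c\<close>, hence at most
  \<open>1 / c\<close> in absolute value.\<close>

lemma one_minus_confluent_limit_bounds:
  assumes "c \<ge> 1 / 2" "y \<ge> 0"
  shows "0 \<le> c * (1 - confluent_limit c (- y))" "c * (1 - confluent_limit c (- y)) \<le> y"
proof -
  show "0 \<le> c * (1 - confluent_limit c (- y))"
    using confluent_limit_abs_le_1[of c "- y"] assms by simp
  have "norm (confluent_limit c 0 - confluent_limit c (- y)) \<le> (1 / c) * norm (0 - - y)"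
  proof (rule field_differentiable_bound[of "{- y..0}"])
    fix z assume z: "z \<in> {- y..0}"
    show "(confluent_limit c has_field_derivative confluent_limit (c + 1) z / c)
        (at z within {- y..0})"
      using assms by (intro DERIV_subset[OF has_field_derivative_confluent_limit]) auto
    show "norm (confluent_limit (c + 1) z / c) \<le> 1 / c"
      using confluent_limit_abs_le_1[of "c + 1" z] assms z by (simp add: divide_right_mono)
  qed (use assms in auto)
  then have "1 - confluent_limit c (- y) \<le> y / c"
    using assms by simp
  then show "c * (1 - confluent_limit c (- y)) \<le> y"
    using assms by (simp add: field_simps)
qed

section \<open>The hypergeometric series of the multiplier and its differential equation\<close>

text \<open>The quotient of the Pochhammer symbols of \<open>a\<close> and \<open>a + 1\<close>
  telescopes to \<open>a / (a + j)\<close>. For \<open>a = 0\<close> the term \<open>j = 0\<close>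
  would become 0 / 0, which evaluates to 0 instead of 1, so that case is treated separately.\<close>

lemma hypergeometric_1_2_ratio:
  fixes a c z :: real
  assumes a: "a > - 1" "a \<noteq> 0"
  shows "hypergeometric [1, a] [2, c + 1, a + 1] z
    = (\<Sum>j. a / (a + real j) * inverse (fact (Suc j) * pochhammer (c + 1) j) * z ^ j)"
  unfolding hypergeometric_def
proof (rule arg_cong[where f = suminf], rule ext)
  fix j
  have p: "pochhammer (a + 1) j > 0"
    using a by (intro pochhammer_pos) simp
  have aj: "a + real j \<noteq> 0"
    using a by (cases j) auto
  have "pochhammer a (Suc j) = a * pochhammer (a + 1) j" "pochhammer a (Suc j) = pochhammer a j * (a + real j)"
    by (rule pochhammer_rec) (rule pochhammer_Suc)
  then have 1: "pochhammer a j = a * pochhammer (a + 1) j / (a + real j)"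
    using aj by (metis nonzero_eq_divide_eq)
  have "(fact (Suc j) :: real) = pochhammer 1 (Suc j)"
    by (simp only: pochhammer_fact)
  also have "\<dots> = pochhammer 2 j"
    by (simp add: pochhammer_rec)
  finally have 2: "pochhammer 2 j = (fact (Suc j) :: real)" ..
  have "(\<Prod>x\<leftarrow>[1, a]. pochhammer x j) / (\<Prod>b\<leftarrow>[2, c + 1, a + 1]. pochhammer b j) * z ^ j / fact j
      = fact j * (a * pochhammer (a + 1) j / (a + real j))
        / (fact (Suc j) * pochhammer (c + 1) j * pochhammer (a + 1) j) * z ^ j / fact j"
    by (simp add: 1 2 pochhammer_fact[symmetric] mult.assoc del: fact_Suc)
  also have "\<dots> = a / (a + real j) * inverse (fact (Suc j) * pochhammer (c + 1) j) * z ^ j"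
    using p by (simp add: divide_inverse mult_ac del: fact_Suc)
  finally show "(\<Prod>x\<leftarrow>[1, a]. pochhammer x j) / (\<Prod>b\<leftarrow>[2, c + 1, a + 1]. pochhammer b j) * z ^ j / fact j
      = a / (a + real j) * inverse (fact (Suc j) * pochhammer (c + 1) j) * z ^ j" .
qed

text \<open>Covers \<open>\<beta> = n + 2\<close>, where the multiplier is minus the squared norm:
  \<open>pochhammer 0 j\<close> vanishes for \<open>j > 0\<close>.\<close>

lemma hypergeometric_0_upper: "hypergeometric [1, 0] bs z = 1"
proof -
  have "(\<Prod>x\<leftarrow>[1, 0]. pochhammer x j) / (\<Prod>b\<leftarrow>bs. pochhammer b j) * z ^ j / fact j
      = (if j = 0 then 1 else 0)" for j
  proof (cases "j = 0")
    case True
    have "map (\<lambda>b. pochhammer b 0) bs = replicate (length bs) (1 :: real)"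
      by (induction bs) auto
    then show ?thesis using True by simp
  qed (simp add: pochhammer_0_left)
  then show ?thesis
    unfolding hypergeometric_def using suminf_finite[of "{0}" "\<lambda>j. if j = 0 then 1 else (0 :: real)"]
    by simp
qed

text \<open>\<open>F\<close> is the weighted mean \<open>a * (LBINT u=0..1. u powr (a - 1) * G (u * y))\<close> when
  \<open>a > 0\<close>. In dimension \<open>n\<close> it is used with \<open>c = n / 2\<close>.\<close>

locale hypergeometric_series =
  fixes a c :: real
  assumes a: "a > - 1" "a \<noteq> 0" and c: "c \<ge> 1 / 2"
begin

definition F :: "real \<Rightarrow> real" where
  "F y = hypergeometric [1, a] [2, c + 1, a + 1] (- y)"

text \<open>The coefficients of \<open>F\<close> without the ratio \<open>a / (a + j)\<close>, so
  that \<open>G y\<close> is 1F2(1; 2, c + 1; - y).\<close>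

definition G_coeff :: "nat \<Rightarrow> real" where
  "G_coeff j = inverse (fact (Suc j) * pochhammer (c + 1) j)"

definition G :: "real \<Rightarrow> real" where
  "G y = (\<Sum>j. G_coeff j * (- y) ^ j)"

lemma abs_G_coeff_le: "\<bar>G_coeff j\<bar> \<le> inverse (fact j * pochhammer (c + 1) j)"
proof -
  have "pochhammer (c + 1) j > 0"
    using c by (intro pochhammer_pos) simp
  moreover from this have "fact j * pochhammer (c + 1) j \<le> fact (Suc j) * pochhammer (c + 1) j"
    by (intro mult_right_mono fact_mono) auto
  ultimately show ?thesis
    unfolding G_coeff_def by (simp add: abs_mult le_imp_inverse_le del: fact_Suc)
qed

text \<open>The summand 1 is the value at \<open>j = 0\<close>; among \<open>j \<ge> 1\<close> the
  denominator is smallest at \<open>j = 1\<close>.\<close>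

lemma abs_ratio_le: "\<bar>a / (a + real j)\<bar> \<le> 1 + \<bar>a\<bar> / (a + 1)"
proof (cases "j = 0")
  case False
  then have "a + 1 \<le> a + real j" by simp
  then have "\<bar>a\<bar> / (a + real j) \<le> \<bar>a\<bar> / (a + 1)"
    using a by (intro divide_left_mono) auto
  then show ?thesis
    using a False by (simp add: abs_divide)
qed (use a in auto)

lemma summable_G: "summable (\<lambda>j. G_coeff j * z ^ j)"
  using c abs_G_coeff_le by (intro summable_dominated_by_confluent_limit[of "c + 1" _ 1]) auto

lemma summable_F: "summable (\<lambda>j. (a / (a + real j) * G_coeff j) * z ^ j)"
proof (rule summable_dominated_by_confluent_limit[of "c + 1"])
  show "\<bar>a / (a + real j) * G_coeff j\<bar>
      \<le> (1 + \<bar>a\<bar> / (a + 1)) * inverse (fact j * pochhammer (c + 1) j)" for j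
    unfolding abs_mult by (intro mult_mono abs_ratio_le abs_G_coeff_le) (use a in auto)
qed (use c in auto)

lemma F_eq: "F y = (\<Sum>j. (a / (a + real j) * G_coeff j) * (- y) ^ j)"
  unfolding F_def using a by (subst hypergeometric_1_2_ratio) (auto simp: G_coeff_def)

text \<open>Since \<open>pochhammer c (Suc j) = c * pochhammer (c + 1) j\<close>, the series of
  \<open>G\<close> is that of 0F1 without its constant term, shifted by one index.\<close>

lemma G_eq: "y * G y = c * (1 - confluent_limit c (- y))"
proof -
  have c0: "c > 0" using c by simp
  let ?d = "\<lambda>j. inverse (fact j * pochhammer c j)"
  have summand: "?d (Suc j) * (- y) ^ Suc j = (- y / c) * (G_coeff j * (- y) ^ j)" for j
    by (simp add: G_coeff_def pochhammer_rec divide_inverse mult_ac del: fact_Suc)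
  have "confluent_limit c (- y) = 1 + (\<Sum>j. ?d (Suc j) * (- y) ^ Suc j)"
    unfolding confluent_limit_def
    using suminf_split_initial_segment[OF summable_confluent_limit'[OF c0, of "- y"], of 1] by simp
  also have "(\<Sum>j. ?d (Suc j) * (- y) ^ Suc j) = (\<Sum>j. (- y / c) * (G_coeff j * (- y) ^ j))"
    unfolding summand ..
  also have "(\<Sum>j. (- y / c) * (G_coeff j * (- y) ^ j)) = (- y / c) * G y"
    unfolding G_def by (intro suminf_mult summable_G)
  finally show ?thesis
    using c0 by (simp add: field_simps)
qed

lemma G_bounds:
  assumes "y > 0"
  shows "0 \<le> G y" "G y \<le> 1"
proof -
  have "0 \<le> y * G y" "y * G y \<le> y * 1"
    unfolding G_eq using one_minus_confluent_limit_bounds[OF c, of y] assms by auto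
  then show "0 \<le> G y" "G y \<le> 1"
    using assms by (auto simp: zero_le_mult_iff mult_le_cancel_left_pos)
qed

lemma F_0: "F 0 = 1"
  unfolding F_eq minus_zero powser_zero using a by (simp add: G_coeff_def)

text \<open>With d_j the coefficients of \<open>F\<close>, this is (a + j) * d_j = a *
  \<open>G_coeff j\<close> summed over \<open>j\<close>. The factor \<open>y\<close> keeps the
  equation valid at \<open>y = 0\<close>, where differentiability is needed later.\<close>

lemma has_derivative_F: "\<exists>F'. (F has_real_derivative F') (at y) \<and> y * F' = a * (G y - F y)"
proof -
  let ?d = "\<lambda>j. a / (a + real j) * G_coeff j"
  let ?D = "\<Sum>j. diffs ?d j * (- y) ^ j"
  have "((\<lambda>z. \<Sum>j. ?d j * z ^ j) has_real_derivative ?D) (at (- y))"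
    by (intro termdiffs_strong_converges_everywhere summable_F)
  then have "((\<lambda>y. \<Sum>j. ?d j * (- y) ^ j) has_real_derivative ?D * (- 1)) (at y)"
    by (rule DERIV_chain2[where g = uminus]) (auto intro!: derivative_eq_intros)
  then have deriv: "(F has_real_derivative - ?D) (at y)"
    by (simp add: F_eq[abs_def])
  have "(\<lambda>j. real j * ?d j * (- y) ^ (j - Suc 0)) sums ?D"
    by (intro diffs_equiv termdiff_converges_all summable_F)
  \<comment> \<open>Multiplying by \<open>- y\<close> restores the power lost in differentiation;
    the term \<open>j = 0\<close> vanishes through \<open>real j\<close>.\<close>
  then have "(\<lambda>j. (real j * ?d j * (- y) ^ (j - Suc 0)) * (- y)) sums (?D * (- y))"
    by (rule sums_mult2)
  moreover have "(real j * ?d j * (- y) ^ (j - Suc 0)) * (- y)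
      = a * (G_coeff j * (- y) ^ j - ?d j * (- y) ^ j)" for j
  proof (cases j)
    case (Suc i)
    have "real j * ?d j = a * (G_coeff j - ?d j)"
      using a Suc by (simp add: field_simps)
    moreover have "(- y) ^ (j - Suc 0) * (- y) = (- y) ^ j"
      using Suc by simp
    ultimately show ?thesis
      by (metis (no_types, lifting) left_diff_distrib mult.assoc)
  qed (use a in simp)
  moreover have "(\<lambda>j. a * (G_coeff j * (- y) ^ j - ?d j * (- y) ^ j)) sums (a * (G y - F y))"
    unfolding F_eq G_def
    by (intro sums_mult sums_diff summable_sums summable_G summable_F)
  ultimately have "y * - ?D = a * (G y - F y)"
    using sums_unique2 by (auto simp: mult.commute)
  then show ?thesis
    using deriv by blast
qed

text \<open>\<open>y powr a\<close> is the integrating factor of y F' + a F = a G.\<close>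

lemma has_derivative_powr_F:
  assumes "y > 0"
  shows "((\<lambda>y. y powr a * F y) has_real_derivative a * y powr (a - 1) * G y) (at y)"
proof -
  obtain F' where F': "(F has_real_derivative F') (at y)" "y * F' = a * (G y - F y)"
    using has_derivative_F by blast
  have "((\<lambda>y. y powr a * F y) has_real_derivative
      y powr a * F' + a * y powr (a - 1) * F y) (at y)"
    using assms F'(1) by (auto intro!: derivative_eq_intros)
  also have "y powr a = y powr (a - 1) * y"
    using assms powr_mult_base[of y "a - 1"] by (simp add: mult.commute)
  also have "y powr (a - 1) * y * F' + a * y powr (a - 1) * F y = a * y powr (a - 1) * G y"
    unfolding mult.assoc F'(2) by (simp add: algebra_simps)
  finally show ?thesis .
qed

lemma powr_F_mono:
  assumes "a > 0" "0 < y" "y \<le> y'"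
  shows "y powr a * F y \<le> y' powr a * F y'"
proof (rule DERIV_nonneg_imp_nondecreasing[OF assms(3)], intro exI conjI)
  fix x assume "y \<le> x"
  then show "((\<lambda>y. y powr a * F y) has_real_derivative a * x powr (a - 1) * G x) (at x)"
    using assms by (intro has_derivative_powr_F) simp
  show "0 \<le> a * x powr (a - 1) * G x"
    using assms G_bounds(1)[of x] \<open>y \<le> x\<close> by simp
qed

lemma continuous_F: "continuous (at y) F"
  using has_derivative_F DERIV_isCont by blast

text \<open>Near 0 the function is close to \<open>F 0 = 1\<close>; monotonicity of
  \<open>y powr a * F y\<close> carries positivity from there to every \<open>y\<close>.\<close>

lemma F_pos:
  assumes "a > 0" "y > 0"
  shows "F y > 0"
proof -
  have "(F \<longlongrightarrow> 1) (at_right 0)"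
    using continuous_F[of 0] by (simp add: continuous_at F_0 filterlim_at_split)
  then have "\<forall>\<^sub>F x in at_right 0. F x > 0"
    by (rule order_tendstoD) simp
  moreover have "\<forall>\<^sub>F x in at_right 0. x < y \<and> x > 0"
    using assms by (auto simp: eventually_at_right_field)
  ultimately have "\<forall>\<^sub>F x in at_right 0. F x > 0 \<and> x < y \<and> x > 0"
    by eventually_elim simp
  then obtain x where x: "F x > 0" "x < y" "x > 0"
    using eventually_happens trivial_limit_at_right_real by blast
  then have "0 < x powr a * F x" by simp
  also have "\<dots> \<le> y powr a * F y"
    using x assms by (intro powr_F_mono) auto
  finally show ?thesis
    using assms by (simp add: zero_less_mult_iff)
qed

text \<open>For negative \<open>a\<close> the integrating factor is applied to \<open>F - 1\<close>, since \<open>y powr a\<close> is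
  singular at \<open>0\<close>.\<close>

lemma F_ge_1:
  assumes "a < 0" "y > 0"
  shows "F y \<ge> 1"
proof -
  define f where "f = (\<lambda>y. y powr a * (F y - 1))"
  have deriv: "(f has_real_derivative a * x powr (a - 1) * (G x - 1)) (at x)" if "x > 0" for x
  proof -
    have "((\<lambda>y. y powr a * F y - y powr a) has_real_derivative
        a * x powr (a - 1) * G x - a * x powr (a - 1)) (at x)"
      by (intro DERIV_diff has_derivative_powr_F has_real_derivative_powr that)
    then show ?thesis
      by (simp add: f_def algebra_simps)
  qed
  have mono: "f x \<le> f y" if "0 < x" "x \<le> y" for x
  proof (rule DERIV_nonneg_imp_nondecreasing[OF that(2)], intro exI conjI)
    fix u assume "x \<le> u"
    then show "(f has_real_derivative a * u powr (a - 1) * (G u - 1)) (at u)"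
      using that by (intro deriv) simp
    show "0 \<le> a * u powr (a - 1) * (G u - 1)"
      using assms G_bounds(2)[of u] that \<open>x \<le> u\<close>
      by (intro mult_nonpos_nonpos) (auto simp: mult_nonpos_nonneg)
  qed
  \<comment> \<open>Here \<open>f x\<close> is \<open>x powr (a + 1)\<close> times the difference
    quotient of \<open>F\<close> at 0. The first factor tends to 0 because \<open>a > - 1\<close>,
    and the second converges to \<open>F'\<close>.\<close>
  obtain F' where "(F has_real_derivative F') (at 0)"
    using has_derivative_F by blast
  then have "((\<lambda>x. (F x - 1) / x) \<longlongrightarrow> F') (at_right 0)"
    by (simp add: has_field_derivative_iff F_0 filterlim_at_split)
  moreover have "((\<lambda>x. x powr (a + 1)) \<longlongrightarrow> 0) (at_right 0)"
    using a by (intro tendsto_zero_powrI[where b = "a + 1"] tendsto_eq_intros)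
      (auto simp: eventually_at_right_field gt_ex)
  ultimately have "((\<lambda>x. x powr (a + 1) * ((F x - 1) / x)) \<longlongrightarrow> 0 * F') (at_right 0)"
    by (intro tendsto_mult)
  moreover have "\<forall>\<^sub>F x in at_right 0. x powr (a + 1) * ((F x - 1) / x) = f x"
    by (auto simp: eventually_at_right_field f_def powr_add intro!: exI[of _ 1])
  ultimately have "(f \<longlongrightarrow> 0) (at_right 0)"
    using filterlim_cong by fastforce
  moreover have "\<forall>\<^sub>F x in at_right 0. f x \<le> f y"
    using assms mono by (auto simp: eventually_at_right_field intro!: exI[of _ y])
  ultimately have "0 \<le> f y"
    using tendsto_upperbound trivial_limit_at_right_real by blast
  then show ?thesis
    using assms by (simp add: f_def zero_le_mult_iff)
qed

end

section \<open>Sign and growth of the multiplier\<close>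

lemma multiplier_altdef:
  fixes \<nu> :: "real ^ 'n" and \<beta> :: real
  defines "a \<equiv> (real CARD('n) + 2 - \<beta>) / 2"
  shows "multiplier \<delta> \<beta> \<nu> = - ((norm \<nu>)\<^sup>2) *
    hypergeometric [1, a] [2, real CARD('n) / 2 + 1, a + 1] (- ((norm \<nu>)\<^sup>2 * (\<delta>\<^sup>2 / 4)))"
proof -
  have "(real CARD('n) + 2) / 2 = real CARD('n) / 2 + 1" "(real CARD('n) + 4 - \<beta>) / 2 = a + 1"
    by (simp_all add: a_def field_simps)
  then show ?thesis
    by (simp only: multiplier_def a_def[symmetric]) (simp add: mult_ac)
qed

lemma hypergeometric_multiplier_pos:
  fixes a c y :: real
  assumes "a > - 1" "c \<ge> 1 / 2" "y > 0"
  shows "hypergeometric [1, a] [2, c + 1, a + 1] (- y) > 0"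
    and "a \<le> 0 \<Longrightarrow> hypergeometric [1, a] [2, c + 1, a + 1] (- y) \<ge> 1"
proof -
  show ge_1: "hypergeometric [1, a] [2, c + 1, a + 1] (- y) \<ge> 1" if "a \<le> 0"
  proof (cases "a = 0")
    case False
    then interpret hypergeometric_series a c
      using assms by unfold_locales
    show ?thesis
      using F_ge_1[of y] False that assms by (simp add: F_def)
  qed (simp add: hypergeometric_0_upper)
  show "hypergeometric [1, a] [2, c + 1, a + 1] (- y) > 0"
  proof (cases "a > 0")
    case True
    then interpret hypergeometric_series a c
      using assms by unfold_locales auto
    show ?thesis
      using F_pos[of y] True assms by (simp add: F_def)
  qed (use ge_1 in auto)
qed

lemma half_card_ge: "real CARD('n::finite) / 2 \<ge> 1 / 2"
  using zero_less_card_finite[where 'a = 'n] by linarith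

lemma multiplier_neg:
  fixes \<nu> :: "real ^ 'n"
  assumes "\<delta> > 0" "\<beta> < real CARD('n) + 4" "\<nu> \<noteq> 0"
  shows "multiplier \<delta> \<beta> \<nu> < 0"
  unfolding multiplier_altdef
  using hypergeometric_multiplier_pos(1)[OF _ half_card_ge[where 'n = 'n],
      of "(real CARD('n) + 2 - \<beta>) / 2" "(norm \<nu>)\<^sup>2 * (\<delta>\<^sup>2 / 4)"] assms
  by simp

text \<open>The condition \<open>n < \<beta>\<close> means \<open>a < 1\<close>. For
  \<open>0 < a < 1\<close>, \<open>F y\<close> is at least a constant times
  \<open>y powr (- a)\<close>, which leaves the exponent \<open>2 - 2 * a\<close>, equal to
  \<open>\<beta> - n\<close>. The threshold \<open>\<rho>\<close> keeps \<open>y\<close> away from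
  0.\<close>

lemma multiplier_growth:
  fixes \<delta> \<beta> \<rho> :: real
  assumes "\<delta> > 0" "real CARD('n) < \<beta>" "\<beta> < real CARD('n) + 4" "\<rho> > 0"
  obtains \<kappa> \<epsilon> where "\<kappa> > 0" "\<epsilon> > 0"
    "\<And>\<nu> :: real ^ 'n. norm \<nu> \<ge> \<rho> \<Longrightarrow> multiplier \<delta> \<beta> \<nu> \<le> - \<kappa> * norm \<nu> powr \<epsilon>"
proof -
  define a c where "a = (real CARD('n) + 2 - \<beta>) / 2" and "c = real CARD('n) / 2"
  define d where "d = \<delta>\<^sup>2 / 4"
  have d: "d > 0" using assms by (simp add: d_def)
  have c: "c \<ge> 1 / 2"
    unfolding c_def by (rule half_card_ge)
  have a1: "a > - 1" "a < 1"
    using assms by (auto simp: a_def)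
  have mult: "multiplier \<delta> \<beta> \<nu>
      = - ((norm \<nu>)\<^sup>2) * hypergeometric [1, a] [2, c + 1, a + 1] (- ((norm \<nu>)\<^sup>2 * d))"
    for \<nu> :: "real ^ 'n"
    by (simp add: multiplier_altdef a_def c_def d_def)
  show thesis
  proof (cases "a \<le> 0")
    case True
    show thesis
    proof (rule that[of 1 2])
      fix \<nu> :: "real ^ 'n" assume "norm \<nu> \<ge> \<rho>"
      then have \<nu>: "norm \<nu> > 0" using assms by linarith
      then have "(norm \<nu>)\<^sup>2 * 1
          \<le> (norm \<nu>)\<^sup>2 * hypergeometric [1, a] [2, c + 1, a + 1] (- ((norm \<nu>)\<^sup>2 * d))"
        using a1 c d True by (intro mult_left_mono hypergeometric_multiplier_pos(2)) auto
      then show "multiplier \<delta> \<beta> \<nu> \<le> - 1 * norm \<nu> powr 2"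
        using \<nu> by (simp add: mult powr_numeral)
    qed auto
  next
    case False
    then interpret hypergeometric_series a c
      using a1 c by unfold_locales auto
    \<comment> \<open>The value of \<open>y powr a * F y\<close> at the least admissible
      \<open>y\<close>, hence its minimum over \<open>norm \<nu> \<ge> \<rho>\<close>.\<close>
    define K where "K = (\<rho>\<^sup>2 * d) powr a * F (\<rho>\<^sup>2 * d)"
    have "K > 0"
      unfolding K_def using F_pos[of "\<rho>\<^sup>2 * d"] False assms d by simp
    show thesis
    proof (rule that[of "K * d powr (- a)" "2 - 2 * a"])
      fix \<nu> :: "real ^ 'n" assume le: "norm \<nu> \<ge> \<rho>"
      then have \<nu>: "norm \<nu> > 0" using assms by linarith
      define y where "y = (norm \<nu>)\<^sup>2 * d"
      have y: "\<rho>\<^sup>2 * d \<le> y" "y > 0"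
        using le \<nu> d assms by (auto simp: y_def intro!: mult_right_mono power_mono)
      have "K \<le> y powr a * F y"
        unfolding K_def using False assms d y by (intro powr_F_mono) auto
      then have "y powr (- a) * K \<le> y powr (- a) * (y powr a * F y)"
        by (intro mult_left_mono) auto
      also have "\<dots> = F y"
        using y by (simp add: mult.assoc[symmetric] powr_add[symmetric])
      finally have F: "y powr (- a) * K \<le> F y" .
      have square: "(norm \<nu>)\<^sup>2 = norm \<nu> powr 2"
        using \<nu> by simp
      have "norm \<nu> powr 2 * (norm \<nu> powr 2 * d) powr (- a) = norm \<nu> powr (2 - 2 * a) * d powr (- a)"
        using \<nu> d by (simp add: powr_mult powr_powr powr_add[symmetric] mult.assoc[symmetric]
            del: powr_numeral)
      then have "(norm \<nu>)\<^sup>2 * y powr (- a) = norm \<nu> powr (2 - 2 * a) * d powr (- a)"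
        unfolding y_def square .
      then have "K * d powr (- a) * norm \<nu> powr (2 - 2 * a) = (norm \<nu>)\<^sup>2 * (y powr (- a) * K)"
        by (simp add: mult_ac)
      also have "\<dots> \<le> (norm \<nu>)\<^sup>2 * F y"
        by (intro mult_left_mono F) auto
      finally show "multiplier \<delta> \<beta> \<nu> \<le> - (K * d powr (- a)) * norm \<nu> powr (2 - 2 * a)"
        by (simp add: mult y_def F_def)
    qed (use \<open>K > 0\<close> d a1 in auto)
  qed
qed

section \<open>Frequencies of the torus against lattice norms\<close>

lemma frequency_0 [simp]: "frequency r 0 = 0"
  by (simp add: frequency_def vec_eq_iff)

lemma lattice_norm_ge_1:
  assumes "k \<noteq> 0"
  shows "lattice_norm k \<ge> 1"
proof -
  obtain i where "k $ i \<noteq> 0"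
    using assms by (auto simp: vec_eq_iff)
  then have "1 \<le> \<bar>real_of_int (k $ i)\<bar>" by linarith
  also have "\<dots> \<le> lattice_norm k"
    unfolding lattice_norm_def using component_le_norm_cart[of "\<chi> i. real_of_int (k $ i)" i] by simp
  finally show ?thesis .
qed

lemma norm_frequency_ge:
  fixes r :: "real ^ 'n"
  assumes "\<And>i. r $ i > 0"
  obtains \<rho> where "\<rho> > 0" "\<And>k. norm (frequency r k) \<ge> \<rho> * lattice_norm k"
proof -
  \<comment> \<open>The longest period gives the smallest scaling of a component, hence the constant
    \<open>2 * pi / R\<close>.\<close>
  define R where "R = Max (range (($) r))"
  have R: "r $ i \<le> R" for i
    unfolding R_def by (rule Max_ge) auto
  then have "R > 0"
    using assms less_le_trans by blast
  show thesis
  proof (rule that[of "2 * pi / R"])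
    fix k :: "int ^ 'n"
    have "norm ((2 * pi / R) *\<^sub>R (\<chi> i. real_of_int (k $ i))) \<le> norm (frequency r k)"
    proof (rule norm_le_componentwise_cart)
      fix i
      have "2 * pi * \<bar>real_of_int (k $ i)\<bar> / R \<le> 2 * pi * \<bar>real_of_int (k $ i)\<bar> / r $ i"
        using R[of i] \<open>R > 0\<close> assms[of i] by (intro divide_left_mono) auto
      then show "norm (((2 * pi / R) *\<^sub>R (\<chi> i. real_of_int (k $ i))) $ i) \<le> norm (frequency r k $ i)"
        using \<open>R > 0\<close> assms[of i] by (simp add: frequency_def abs_mult abs_divide)
    qed
    then show "2 * pi / R * lattice_norm k \<le> norm (frequency r k)"
      using \<open>R > 0\<close> by (simp add: lattice_norm_def)
  qed (use \<open>R > 0\<close> in simp)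
qed

section \<open>Sobolev estimates\<close>

text \<open>From (1 + x / p)^p <= exp x at x = c * u, rescaled by
  \<open>(real p / c) ^ p\<close>.\<close>

lemma power_exp_bound:
  fixes c :: real
  assumes "c > 0"
  obtains C where "\<And>u. u \<ge> 0 \<Longrightarrow> u ^ p * exp (- c * u) \<le> C"
proof (cases "p = 0")
  case True
  then show thesis
    using assms by (intro that[of 1]) auto
next
  case False
  show thesis
  proof (rule that[of "(real p / c) ^ p"])
    fix u :: real assume u: "u \<ge> 0"
    have "(c * u / p) ^ p \<le> (1 + c * u / p) ^ p"
      using assms u by (intro power_mono) auto
    also have "\<dots> \<le> exp (c * u)"
      using False assms u by (intro exp_ge_one_plus_x_over_n_power_n) (auto intro: order_trans[of _ 0])
    finally have "(real p / c) ^ p * (c * u / p) ^ p \<le> (real p / c) ^ p * exp (c * u)"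
      using assms by (intro mult_left_mono) auto
    then have "u ^ p \<le> (real p / c) ^ p * exp (c * u)"
      using False assms by (simp add: power_mult_distrib[symmetric])
    then show "u ^ p * exp (- c * u) \<le> (real p / c) ^ p"
      by (simp add: exp_minus field_simps)
  qed
qed

lemma powr_exp_bound:
  fixes c \<epsilon> M :: real
  assumes "c > 0" "\<epsilon> > 0"
  obtains C where "\<And>x. x \<ge> 1 \<Longrightarrow> x powr M * exp (- c * x powr \<epsilon>) \<le> C"
proof -
  \<comment> \<open>Since \<open>x powr \<epsilon> \<ge> 1\<close>, the exponent
    \<open>M / \<epsilon>\<close> may be rounded up to a natural number, which is 0 if
    \<open>M\<close> is negative.\<close>
  define p where "p = nat \<lceil>M / \<epsilon>\<rceil>"
  obtain C where C: "\<And>u. u \<ge> 0 \<Longrightarrow> u ^ p * exp (- c * u) \<le> C"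
    using power_exp_bound[OF assms(1)] by blast
  show thesis
  proof (rule that[of C])
    fix x :: real assume x: "x \<ge> 1"
    have "x powr M = (x powr \<epsilon>) powr (M / \<epsilon>)"
      using assms by (simp add: powr_powr)
    also have "\<dots> \<le> (x powr \<epsilon>) powr real p"
      using x assms by (intro powr_mono ge_one_powr_ge_zero) (auto simp: p_def real_nat_ceiling_ge)
    also have "\<dots> = (x powr \<epsilon>) ^ p"
      using x by (simp add: powr_realpow)
    finally have "x powr M * exp (- c * x powr \<epsilon>) \<le> (x powr \<epsilon>) ^ p * exp (- c * x powr \<epsilon>)"
      by (intro mult_right_mono) auto
    also have "\<dots> \<le> C"
      by (rule C) simp
    finally show "x powr M * exp (- c * x powr \<epsilon>) \<le> C" .
  qed
qed

abbreviation sobolev_weight :: "int ^ 'n \<Rightarrow> real" where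
  "sobolev_weight k \<equiv> 1 + (lattice_norm k)\<^sup>2"

text \<open>Squaring turns the exponent \<open>(s - q) / 2\<close> into \<open>s - q\<close>, which
  exchanges the weight of order \<open>q\<close> for that of order \<open>s\<close>. The sign of
  \<open>C\<close> is left open, hence \<open>\<bar>C\<bar>\<close>.\<close>

lemma dominated_in_sobolev_space:
  fixes h b :: "('n::finite) fourier_coeffs"
  assumes b: "b \<in> sobolev_space s"
    and le: "\<And>k. norm (h k) \<le> C * sobolev_weight k powr ((s - q) / 2) * norm (b k)"
  shows "h \<in> sobolev_space q" "sobolev_norm q h \<le> \<bar>C\<bar> * sobolev_norm s b"
proof -
  have w: "sobolev_weight k > 0" for k :: "int ^ 'n"
    by (simp add: add_pos_nonneg)
  let ?S = "\<lambda>s (h :: 'n fourier_coeffs) k. sobolev_weight k powr s * (norm (h k))\<^sup>2"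
  obtain A M where AM: "\<And>k. norm (b k) \<le> A * sobolev_weight k powr M"
    using b by (auto simp: sobolev_space_def periodic_distributions_def)
  have le': "norm (h k) \<le> \<bar>C\<bar> * sobolev_weight k powr ((s - q) / 2) * norm (b k)" for k
    by (rule order_trans[OF le]) (intro mult_right_mono, auto)
  have "norm (h k) \<le> \<bar>C\<bar> * A * sobolev_weight k powr ((s - q) / 2 + M)" for k
  proof -
    note le'[of k]
    also have "\<bar>C\<bar> * sobolev_weight k powr ((s - q) / 2) * norm (b k)
        \<le> \<bar>C\<bar> * sobolev_weight k powr ((s - q) / 2) * (A * sobolev_weight k powr M)"
      by (intro mult_left_mono AM) auto
    finally show ?thesis
      by (simp add: powr_add mult_ac)
  qed
  then have h: "h \<in> periodic_distributions"
    unfolding periodic_distributions_def by blast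
  have sq: "?S q h k \<le> C\<^sup>2 * ?S s b k" for k
  proof -
    have "(norm (h k))\<^sup>2 \<le> (\<bar>C\<bar> * sobolev_weight k powr ((s - q) / 2) * norm (b k))\<^sup>2"
      by (intro power_mono le') auto
    also have "(sobolev_weight k powr ((s - q) / 2))\<^sup>2 = sobolev_weight k powr (s - q)"
      by (simp add: power2_eq_square powr_add[symmetric])
    then have "(\<bar>C\<bar> * sobolev_weight k powr ((s - q) / 2) * norm (b k))\<^sup>2
        = C\<^sup>2 * sobolev_weight k powr (s - q) * (norm (b k))\<^sup>2"
      by (simp add: power_mult_distrib)
    finally have "?S q h k
        \<le> sobolev_weight k powr q * (C\<^sup>2 * sobolev_weight k powr (s - q) * (norm (b k))\<^sup>2)"
      by (intro mult_left_mono) auto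
    also have "\<dots> = C\<^sup>2 * (sobolev_weight k powr q * sobolev_weight k powr (s - q)) * (norm (b k))\<^sup>2"
      by (simp only: mult_ac)
    finally show ?thesis
      by (simp add: powr_add[symmetric] mult.assoc)
  qed
  have sum_b: "(\<lambda>k. C\<^sup>2 * ?S s b k) summable_on UNIV"
    using b by (intro summable_on_cmult_right) (simp add: sobolev_space_def)
  then have sum_h: "?S q h summable_on UNIV"
    by (rule summable_on_comparison_test) (use sq in auto)
  then show "h \<in> sobolev_space q"
    using h by (simp add: sobolev_space_def)
  have "sobolev_norm q h \<le> sqrt (\<Sum>\<^sub>\<infinity>k. C\<^sup>2 * ?S s b k)"
    unfolding sobolev_norm_def by (intro real_sqrt_le_mono infsum_mono sum_h sum_b sq)
  also have "\<dots> = \<bar>C\<bar> * sobolev_norm s b"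
    by (simp add: sobolev_norm_def infsum_cmult_right' real_sqrt_mult)
  finally show "sobolev_norm q h \<le> \<bar>C\<bar> * sobolev_norm s b" .
qed

lemma bounded_multiple_periodic:
  assumes "b \<in> periodic_distributions" "\<And>k. \<bar>\<phi> k\<bar> \<le> C"
  shows "(\<lambda>k. of_real (\<phi> k) * b k) \<in> periodic_distributions"
proof -
  obtain A M where AM: "\<And>k. norm (b k) \<le> A * sobolev_weight k powr M"
    using assms(1) by (auto simp: periodic_distributions_def)
  have "C \<ge> 0"
    using assms(2)[of 0] by linarith
  then have "norm (of_real (\<phi> k) * b k) \<le> C * (A * sobolev_weight k powr M)" for k
    unfolding norm_mult norm_of_real by (intro mult_mono assms(2) AM) auto
  then show ?thesis
    unfolding periodic_distributions_def mult.assoc[symmetric] by blast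
qed

section \<open>Difference quotients and Gateaux derivatives\<close>

text \<open>The mean value inequality is used twice: on \<open>f'\<close>, and on
  \<open>f x - f' t * x\<close>, whose derivative is \<open>f' x - f' t\<close>. The closed segment
  handles both signs of \<open>h\<close>.\<close>

lemma difference_quotient_bound:
  fixes f f' f'' :: "real \<Rightarrow> real"
  assumes S: "convex S" "t \<in> S" "t + h \<in> S" and "h \<noteq> 0"
    and f: "\<And>x. x \<in> S \<Longrightarrow> (f has_real_derivative f' x) (at x)"
    and f': "\<And>x. x \<in> S \<Longrightarrow> (f' has_real_derivative f'' x) (at x)"
    and B: "\<And>x. x \<in> S \<Longrightarrow> \<bar>f'' x\<bar> \<le> B"
  shows "\<bar>1 / h * (f (t + h) - f t) - f' t\<bar> \<le> B * \<bar>h\<bar>"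
proof -
  let ?T = "closed_segment t (t + h)"
  have T: "?T \<subseteq> S"
    using S by (simp add: closed_segment_subset)
  have B0: "B \<ge> 0"
    using B[OF S(2)] by linarith
  have lip: "\<bar>f' x - f' t\<bar> \<le> B * \<bar>h\<bar>" if "x \<in> ?T" for x
  proof -
    have "norm (f' x - f' t) \<le> B * norm (x - t)"
      by (rule field_differentiable_bound[OF S(1), of _ f''])
        (use T that S(2) B in \<open>auto intro: has_field_derivative_at_within[OF f']\<close>)
    also have "\<dots> \<le> B * \<bar>h\<bar>"
      using that B0 by (intro mult_left_mono) (auto simp: closed_segment_eq_real_ivl split: if_splits)
    finally show ?thesis by simp
  qed
  have "norm ((f (t + h) - f' t * (t + h)) - (f t - f' t * t)) \<le> B * \<bar>h\<bar> * norm (t + h - t)"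
  proof (rule field_differentiable_bound[of ?T _ "\<lambda>x. f' x - f' t"])
    fix x assume x: "x \<in> ?T"
    show "((\<lambda>x. f x - f' t * x) has_field_derivative f' x - f' t) (at x within ?T)"
      using x T
      by (intro has_field_derivative_at_within[where s = ?T]) (auto intro!: derivative_eq_intros f)
  qed (use lip in auto)
  also have "(f (t + h) - f' t * (t + h)) - (f t - f' t * t)
      = h * (1 / h * (f (t + h) - f t) - f' t)"
    using \<open>h \<noteq> 0\<close> by (simp add: field_simps)
  finally show ?thesis
    using \<open>h \<noteq> 0\<close> by (simp add: abs_mult mult.commute[of _ "\<bar>h\<bar>"])
qed

text \<open>For \<open>\<bar>h\<bar> < t / 2\<close> the times \<open>t\<close> and
  \<open>t + h\<close> lie in \<open>{t / 2..}\<close>, where the bound on \<open>\<phi>''\<close>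
  applies. The error is then of size \<open>\<bar>h\<bar>\<close> in order \<open>q\<close>, while
  boundedness of \<open>\<phi>\<close> and \<open>\<phi>'\<close> only makes \<open>W\<close> and
  \<open>Z\<close> distributions.\<close>

lemma has_gateaux_derivative_coefficientwise:
  fixes \<phi> \<phi>' \<phi>'' :: "int ^ 'n \<Rightarrow> real \<Rightarrow> real" and b :: "('n::finite) fourier_coeffs"
  assumes b: "b \<in> sobolev_space s" and "t > 0"
    and W: "\<And>\<tau> k. \<tau> > 0 \<Longrightarrow> W \<tau> k = of_real (\<phi> k \<tau>) * b k"
    and Z: "\<And>k. Z k = of_real (\<phi>' k t) * b k"
    and deriv: "\<And>k x. x > 0 \<Longrightarrow> (\<phi> k has_real_derivative \<phi>' k x) (at x)"
      "\<And>k x. x > 0 \<Longrightarrow> (\<phi>' k has_real_derivative \<phi>'' k x) (at x)"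
    and bounds: "\<And>\<tau>. \<tau> > 0 \<Longrightarrow> \<exists>C. \<forall>k. \<bar>\<phi> k \<tau>\<bar> \<le> C" "\<exists>C. \<forall>k. \<bar>\<phi>' k t\<bar> \<le> C"
    and remainder: "\<And>k x. x \<ge> t / 2 \<Longrightarrow> \<bar>\<phi>'' k x\<bar> \<le> C * sobolev_weight k powr ((s - q) / 2)"
  shows "has_gateaux_derivative q W Z t"
proof -
  have b': "b \<in> periodic_distributions"
    using b by (simp add: sobolev_space_def)
  have W_periodic: "W \<tau> \<in> periodic_distributions" if pos: "\<tau> > 0" for \<tau>
  proof -
    obtain C where "\<And>k. \<bar>\<phi> k \<tau>\<bar> \<le> C" using bounds(1)[OF pos] by blast
    moreover have "W \<tau> = (\<lambda>k. of_real (\<phi> k \<tau>) * b k)" using W[OF pos] by blast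
    ultimately show ?thesis
      using bounded_multiple_periodic[OF b', of "\<lambda>k. \<phi> k \<tau>" C] by simp
  qed
  have Z_periodic: "Z \<in> periodic_distributions"
  proof -
    obtain C where "\<And>k. \<bar>\<phi>' k t\<bar> \<le> C" using bounds(2) by blast
    moreover have "Z = (\<lambda>k. of_real (\<phi>' k t) * b k)" using Z by blast
    ultimately show ?thesis
      using bounded_multiple_periodic[OF b', of "\<lambda>k. \<phi>' k t" C] by simp
  qed
  have error: "norm (gateaux_error W Z t h k)
      \<le> (C * \<bar>h\<bar>) * sobolev_weight k powr ((s - q) / 2) * norm (b k)"
    if h: "\<bar>h\<bar> < t / 2" "h \<noteq> 0" for h k
  proof -
    have "\<bar>1 / h * (\<phi> k (t + h) - \<phi> k t) - \<phi>' k t\<bar>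
        \<le> C * sobolev_weight k powr ((s - q) / 2) * \<bar>h\<bar>"
      using h \<open>t > 0\<close>
      by (intro difference_quotient_bound[of "{t / 2..}" _ _ _ _ "\<phi>'' k"] deriv remainder) auto
    then have "\<bar>1 / h * (\<phi> k (t + h) - \<phi> k t) - \<phi>' k t\<bar> * norm (b k)
        \<le> C * sobolev_weight k powr ((s - q) / 2) * \<bar>h\<bar> * norm (b k)"
      by (rule mult_right_mono) simp
    moreover have "gateaux_error W Z t h k
        = of_real (1 / h * (\<phi> k (t + h) - \<phi> k t) - \<phi>' k t) * b k"
      using h \<open>t > 0\<close> by (simp add: gateaux_error_def W Z algebra_simps)
    then have "norm (gateaux_error W Z t h k)
        = \<bar>1 / h * (\<phi> k (t + h) - \<phi> k t) - \<phi>' k t\<bar> * norm (b k)"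
      by (simp only: norm_mult norm_of_real)
    ultimately show ?thesis
      by (simp only: mult_ac)
  qed
  have near: "\<forall>\<^sub>F h in at 0. \<bar>h\<bar> < t / 2 \<and> h \<noteq> 0"
    using \<open>t > 0\<close> by (auto simp: eventually_at dist_real_def intro!: exI[of _ "t / 2"])
  have "\<forall>\<^sub>F h in at 0. gateaux_error W Z t h \<in> sobolev_space q"
    using near by eventually_elim (use dominated_in_sobolev_space(1)[OF b error] in blast)
  moreover have "((\<lambda>h. sobolev_norm q (gateaux_error W Z t h)) \<longlongrightarrow> 0) (at 0)"
  proof (rule tendsto_sandwich)
    show "\<forall>\<^sub>F h in at 0. 0 \<le> sobolev_norm q (gateaux_error W Z t h)"
      by (intro always_eventually) (auto simp: sobolev_norm_def intro!: infsum_nonneg)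
    show "\<forall>\<^sub>F h in at 0. sobolev_norm q (gateaux_error W Z t h) \<le> \<bar>C * \<bar>h\<bar>\<bar> * sobolev_norm s b"
      using near by eventually_elim (use dominated_in_sobolev_space(2)[OF b error] in blast)
    show "((\<lambda>h. \<bar>C * \<bar>h\<bar>\<bar> * sobolev_norm s b) \<longlongrightarrow> 0) (at 0)"
      by (auto intro!: tendsto_eq_intros)
  qed auto
  moreover have "\<forall>\<^sub>F \<tau> in nhds t. W \<tau> \<in> periodic_distributions"
    using eventually_nhds_in_open[of "{0<..}" t] \<open>t > 0\<close>
    by (auto elim!: eventually_mono intro: W_periodic)
  ultimately show ?thesis
    using Z_periodic by (simp add: has_gateaux_derivative_def)
qed

lemma sobolev_weight_le:
  assumes "k \<noteq> 0"
  shows "sobolev_weight k \<le> 2 * (lattice_norm k)\<^sup>2"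
  using one_le_power[OF lattice_norm_ge_1[OF assms], of 2] by simp

lemma bounded_power_exp:
  fixes m :: "'a \<Rightarrow> real"
  assumes "\<And>k. m k \<le> 0" "t > 0"
  obtains C where "\<And>k. \<bar>m k ^ p * exp (m k * t)\<bar> \<le> C"
proof -
  obtain C where C: "\<And>u. u \<ge> 0 \<Longrightarrow> u ^ p * exp (- t * u) \<le> C"
    using power_exp_bound[OF assms(2)] by blast
  show thesis
  proof (rule that[of C])
    show "\<bar>m k ^ p * exp (m k * t)\<bar> \<le> C" for k
      using C[of "- m k"] assms(1)[of k] by (simp add: abs_mult power_abs mult.commute)
  qed
qed

text \<open>The alternative covers the two regimes: if \<open>m\<close> is merely nonpositive, no regularity is gained, whereas
  polynomial growth of \<open>- m\<close> makes \<open>exp (m k * t)\<close> decay faster than every power of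
  the weight.\<close>

lemma multiplier_smoothing:
  fixes m :: "int ^ 'n \<Rightarrow> real"
  assumes m: "\<And>k. m k \<le> 0" and "t > 0"
    and growth: "q = s \<or> (\<exists>\<kappa>>0. \<exists>\<epsilon>>0. \<forall>k. k \<noteq> 0 \<longrightarrow> m k \<le> - \<kappa> * lattice_norm k powr \<epsilon>)"
  obtains C where "\<And>k. \<bar>m k ^ p * exp (m k * t)\<bar> \<le> C * sobolev_weight k powr ((s - q) / 2)"
  using growth
proof (elim disjE exE conjE)
  assume "q = s"
  obtain C where "\<And>k. \<bar>m k ^ p * exp (m k * t)\<bar> \<le> C"
    using bounded_power_exp[of m t p, OF m \<open>t > 0\<close>] by metis
  then show thesis
    using \<open>q = s\<close> by (intro that[of C]) (simp add: add_nonneg_eq_0_iff)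
next
  fix \<kappa> \<epsilon> :: real
  assume pos: "\<kappa> > 0" "\<epsilon> > 0" and le: "\<forall>k. k \<noteq> 0 \<longrightarrow> m k \<le> - \<kappa> * lattice_norm k powr \<epsilon>"
  \<comment> \<open>Half of the time absorbs the power of \<open>m k\<close>, the other half the
    weight. The factor \<open>(1 / 2) powr (\<epsilon> / 2)\<close> comes from
    \<open>sobolev_weight k \<le> 2 * (lattice_norm k)\<^sup>2\<close>.\<close>
  define c where "c = \<kappa> * (1 / 2) powr (\<epsilon> / 2) * (t / 2)"
  have "c > 0"
    using pos \<open>t > 0\<close> by (simp add: c_def)
  obtain A where A: "\<And>k. \<bar>m k ^ p * exp (m k * (t / 2))\<bar> \<le> A"
    using bounded_power_exp[of m "t / 2" p, OF m half_gt_zero[OF \<open>t > 0\<close>]] by metis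
  obtain B where B: "\<And>x. x \<ge> 1 \<Longrightarrow> x powr ((q - s) / 2) * exp (- c * x powr (\<epsilon> / 2)) \<le> B"
    using powr_exp_bound[OF \<open>c > 0\<close>, of "\<epsilon> / 2"] pos by auto
  \<comment> \<open>The 1 in the maximum serves \<open>k = 0\<close>, where the weight is 1 and the
    growth assumption is silent.\<close>
  have decay: "sobolev_weight k powr ((q - s) / 2) * exp (m k * (t / 2)) \<le> max 1 B" for k
  proof (cases "k = 0")
    case True
    then have "lattice_norm k = 0"
      by (simp add: lattice_norm_def norm_eq_zero vec_eq_iff)
    then show ?thesis
      using m[of k] \<open>t > 0\<close> by (simp add: mult_nonpos_nonneg le_max_iff_disj)
  next
    case False
    have \<lambda>: "lattice_norm k > 0"
      using lattice_norm_ge_1[OF False] by linarith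
    have "(1 / 2) powr (\<epsilon> / 2) * sobolev_weight k powr (\<epsilon> / 2) = (sobolev_weight k / 2) powr (\<epsilon> / 2)"
      by (simp add: powr_divide powr_one_eq_one)
    also have "\<dots> \<le> ((lattice_norm k)\<^sup>2) powr (\<epsilon> / 2)"
      using sobolev_weight_le[OF False] pos by (intro powr_mono2) auto
    also have "\<dots> = lattice_norm k powr \<epsilon>"
      using \<lambda> powr_powr[of "lattice_norm k" 2 "\<epsilon> / 2"] by simp
    finally have "\<kappa> * ((1 / 2) powr (\<epsilon> / 2) * sobolev_weight k powr (\<epsilon> / 2))
        \<le> \<kappa> * lattice_norm k powr \<epsilon>"
      using pos by (intro mult_left_mono) auto
    also have "\<dots> \<le> - m k"
      using le False by auto
    finally have "\<kappa> * ((1 / 2) powr (\<epsilon> / 2) * sobolev_weight k powr (\<epsilon> / 2)) * (t / 2)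
        \<le> - m k * (t / 2)"
      using \<open>t > 0\<close> by (intro mult_right_mono) auto
    then have "exp (m k * (t / 2)) \<le> exp (- c * sobolev_weight k powr (\<epsilon> / 2))"
      by (simp add: c_def mult_ac)
    then have "sobolev_weight k powr ((q - s) / 2) * exp (m k * (t / 2))
        \<le> sobolev_weight k powr ((q - s) / 2) * exp (- c * sobolev_weight k powr (\<epsilon> / 2))"
      by (rule mult_left_mono) simp
    also have "\<dots> \<le> B"
      by (rule B) simp
    finally show ?thesis by simp
  qed
  show thesis
  proof (rule that[of "A * max 1 B"])
    fix k :: "int ^ 'n"
    have w: "sobolev_weight k > 0"
      by (simp add: add_pos_nonneg)
    have "exp (m k * t) = exp (m k * (t / 2)) * exp (m k * (t / 2))"
      by (simp add: exp_add[symmetric])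
    moreover have "sobolev_weight k powr ((q - s) / 2) * sobolev_weight k powr ((s - q) / 2) = 1"
      using w by (simp add: powr_add[symmetric] field_simps)
    ultimately have "\<bar>m k ^ p * exp (m k * t)\<bar> = \<bar>m k ^ p * exp (m k * (t / 2))\<bar>
        * (sobolev_weight k powr ((q - s) / 2) * exp (m k * (t / 2)))
        * sobolev_weight k powr ((s - q) / 2)"
      by (simp add: abs_mult)
    also have "\<dots> \<le> A * max 1 B * sobolev_weight k powr ((s - q) / 2)"
      using A[of k] by (intro mult_right_mono mult_mono A decay) auto
    finally show "\<bar>m k ^ p * exp (m k * t)\<bar>
        \<le> A * max 1 B * sobolev_weight k powr ((s - q) / 2)" .
  qed
qed

section \<open>Time derivatives of the Fourier series, mode by mode\<close>

text \<open>The conditional assumption on \<open>q\<close> merges both regimes: without smoothing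
  \<open>q\<close> must be \<open>s\<close>, otherwise it is arbitrary. For \<open>k = 0\<close> and
  \<open>N = 1\<close> the formula relies on 0 ^ 0 = 1.\<close>

theorem proposition3:
  fixes r :: "real ^ 'n" and \<delta> \<beta> s q :: real
    and b :: "('n::finite) fourier_coeffs"
    and m :: "int ^ 'n \<Rightarrow> real"
    and U V :: "real \<Rightarrow> 'n fourier_coeffs"
  assumes r: "\<And>i. r $ i > 0"
    and \<delta>: "\<delta> > 0"
    and \<beta>: "\<beta> < real CARD('n) + 4"
    and b: "b \<in> sobolev_space s"
    and m: "\<And>k. m k = multiplier \<delta> \<beta> (frequency r k)"
    and U: "\<And>t k. t \<ge> 0 \<Longrightarrow>
      U t k = (if k = 0 then b 0 * of_real t
               else of_real ((exp (m k * t) - 1) / m k) * b k)"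
    and V: "\<And>t k. t \<ge> 0 \<Longrightarrow> V t k = of_real (exp (m k * t)) * b k"
    and q: "\<beta> \<le> real CARD('n) \<Longrightarrow> q = s"
  shows "(\<forall>t>0. has_gateaux_derivative q U (V t) t) \<and>
    (\<forall>N\<ge>1. has_nth_gateaux_derivative q N U
       (\<lambda>t k. b k * of_real (m k ^ (N - 1) * exp (m k * t))))"
proof -
  obtain \<rho> where \<rho>: "\<rho> > 0" "\<And>k. norm (frequency r k) \<ge> \<rho> * lattice_norm k"
    using norm_frequency_ge[of r] r by blast
  have freq_ge: "norm (frequency r k) \<ge> \<rho>" if "k \<noteq> 0" for k
  proof -
    have "\<rho> * 1 \<le> \<rho> * lattice_norm k"
      using \<rho>(1) lattice_norm_ge_1[OF that] by (intro mult_left_mono) auto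
    then show ?thesis
      using \<rho>(2)[of k] by linarith
  qed
  have m_0: "m 0 = 0"
    by (simp add: m multiplier_def)
  have m_neg: "m k < 0" if "k \<noteq> 0" for k
  proof -
    have "frequency r k \<noteq> 0"
      using freq_ge[OF that] \<rho>(1) by auto
    then show ?thesis
      unfolding m using \<delta> \<beta> by (intro multiplier_neg)
  qed
  have m_nonpos: "m k \<le> 0" for k
    using m_neg[of k] m_0 by (cases "k = 0") auto
  have growth: "q = s \<or> (\<exists>\<kappa>>0. \<exists>\<epsilon>>0. \<forall>k. k \<noteq> 0 \<longrightarrow> m k \<le> - \<kappa> * lattice_norm k powr \<epsilon>)"
  proof (cases "\<beta> \<le> real CARD('n)")
    case False
    then obtain \<kappa> \<epsilon> where \<kappa>: "\<kappa> > 0" "\<epsilon> > 0"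
      "\<And>\<nu> :: real ^ 'n. norm \<nu> \<ge> \<rho> \<Longrightarrow> multiplier \<delta> \<beta> \<nu> \<le> - \<kappa> * norm \<nu> powr \<epsilon>"
      using multiplier_growth[OF \<delta> _ \<beta> \<rho>(1)] by (metis not_le)
    have "m k \<le> - (\<kappa> * \<rho> powr \<epsilon>) * lattice_norm k powr \<epsilon>" if "k \<noteq> 0" for k
    proof -
      have "\<kappa> * (\<rho> * lattice_norm k) powr \<epsilon> \<le> \<kappa> * norm (frequency r k) powr \<epsilon>"
        using \<rho> \<kappa> by (intro mult_left_mono powr_mono2) (auto simp: lattice_norm_def)
      then show ?thesis
        using \<kappa>(3)[OF freq_ge[OF that]] \<rho>(1)
        by (simp add: m powr_mult lattice_norm_def mult.assoc)
    qed
    then show ?thesis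
      using \<kappa>(1,2) \<rho>(1) by (intro disjI2 exI[of _ "\<kappa> * \<rho> powr \<epsilon>"] conjI exI[of _ \<epsilon>]) auto
  qed (use q in blast)
  have bounded: "\<exists>C. \<forall>k. \<bar>m k ^ p * exp (m k * t)\<bar> \<le> C" if "t > 0" for p t
    using bounded_power_exp[OF m_nonpos that] by metis
  \<comment> \<open>As \<open>m k \<le> 0\<close>, the exponential decreases in \<open>x\<close>, so
    the estimate at \<open>t / 2\<close> serves all later times.\<close>
  have remainder: "\<exists>C. \<forall>k x. x \<ge> t / 2 \<longrightarrow>
      \<bar>m k ^ p * exp (m k * x)\<bar> \<le> C * sobolev_weight k powr ((s - q) / 2)" if "t > 0" for p t
  proof -
    obtain C where C: "\<And>k. \<bar>m k ^ p * exp (m k * (t / 2))\<bar> \<le> C * sobolev_weight k powr ((s - q) / 2)"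
      using multiplier_smoothing[OF m_nonpos _ growth, of "t / 2"] \<open>t > 0\<close> by auto
    have "\<bar>m k ^ p * exp (m k * x)\<bar> \<le> C * sobolev_weight k powr ((s - q) / 2)" if "x \<ge> t / 2" for k x
    proof -
      have "m k * x \<le> m k * (t / 2)"
        using that m_nonpos by (intro mult_left_mono_neg)
      then have "\<bar>m k ^ p * exp (m k * x)\<bar> \<le> \<bar>m k ^ p * exp (m k * (t / 2))\<bar>"
        unfolding abs_mult by (intro mult_left_mono) auto
      then show ?thesis
        using C[of k] by linarith
    qed
    then show ?thesis by blast
  qed
  have U': "has_gateaux_derivative q U (\<lambda>k. b k * of_real (exp (m k * t))) t" if "t > 0" for t
  proof -
    \<comment> \<open>The zero mode is the limit of the other expression as \<open>m k\<close> tends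
      to 0; the quotient itself would evaluate to 0 there.\<close>
    let ?\<phi> = "\<lambda>k t. if k = 0 then t else (exp (m k * t) - 1) / m k"
    \<comment> \<open>Bounding by \<open>\<tau>\<close> avoids a lower bound on
      \<open>- m k\<close>, so the constant is uniform in \<open>k\<close> even where
      \<open>m k\<close> is close to 0.\<close>
    have bound: "\<bar>?\<phi> k \<tau>\<bar> \<le> \<tau>" if "\<tau> > 0" for k \<tau>
    proof (cases "k = 0")
      case False
      have "1 + m k * \<tau> \<le> exp (m k * \<tau>)"
        by (rule exp_ge_add_one_self)
      moreover have "exp (m k * \<tau>) \<le> 1"
        using m_nonpos[of k] \<open>\<tau> > 0\<close> by (simp add: mult_nonpos_nonneg)
      ultimately have "\<bar>exp (m k * \<tau>) - 1\<bar> \<le> - m k * \<tau>"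
        by linarith
      then show ?thesis
        using m_neg[OF False] False pos_divide_le_eq[of "- m k" "\<bar>exp (m k * \<tau>) - 1\<bar>" \<tau>]
        by (simp add: abs_divide mult.commute del: minus_divide_right)
    qed (use that in simp)
    obtain C where C: "\<forall>k x. x \<ge> t / 2 \<longrightarrow>
        \<bar>m k ^ 1 * exp (m k * x)\<bar> \<le> C * sobolev_weight k powr ((s - q) / 2)"
      using remainder[OF \<open>t > 0\<close>, of 1] by blast
    show ?thesis
    proof (rule has_gateaux_derivative_coefficientwise[OF b \<open>t > 0\<close>, of _ ?\<phi> _ "\<lambda>k t. exp (m k * t)"
          "\<lambda>k t. m k ^ 1 * exp (m k * t)" C])
      show "U \<tau> k = of_real (?\<phi> k \<tau>) * b k" if "\<tau> > 0" for \<tau> k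
        using that by (simp add: U)
      show "(?\<phi> k has_real_derivative exp (m k * x)) (at x)" for k x
        using m_neg[of k] by (cases "k = 0") (auto intro!: derivative_eq_intros simp: m_0)
      show "((\<lambda>t. exp (m k * t)) has_real_derivative m k ^ 1 * exp (m k * x)) (at x)" for k x
        by (auto intro!: derivative_eq_intros)
      show "\<exists>C. \<forall>k. \<bar>?\<phi> k \<tau>\<bar> \<le> C" if "\<tau> > 0" for \<tau>
        using bound[OF that] by blast
      show "\<exists>C. \<forall>k. \<bar>exp (m k * t)\<bar> \<le> C"
        using bounded[OF \<open>t > 0\<close>, of 0] by simp
    qed (use C in auto)
  qed
  \<comment> \<open>The first derivative already has the form
    \<open>m k ^ 0 * exp (m k * t)\<close>; each further one contributes a factor
    \<open>m k\<close>. The index is shifted because \<open>U\<close> itself does not have this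
    form.\<close>
  have nth: "has_nth_gateaux_derivative q (Suc N) U (\<lambda>t k. b k * of_real (m k ^ N * exp (m k * t)))" for N
  proof (induction N)
    case 0
    show ?case
      using U' by auto
  next
    case (Suc N)
    have "has_gateaux_derivative q (\<lambda>t k. b k * of_real (m k ^ N * exp (m k * t)))
        (\<lambda>k. b k * of_real (m k ^ Suc N * exp (m k * t))) t" if "t > 0" for t
    proof -
      obtain C where C: "\<forall>k x. x \<ge> t / 2 \<longrightarrow>
          \<bar>m k ^ Suc (Suc N) * exp (m k * x)\<bar> \<le> C * sobolev_weight k powr ((s - q) / 2)"
        using remainder[OF \<open>t > 0\<close>] by blast
      have deriv: "((\<lambda>t. m k ^ p * exp (m k * t)) has_real_derivative m k ^ Suc p * exp (m k * x)) (at x)"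
        for k x p
        by (auto intro!: derivative_eq_intros)
      show ?thesis
        by (rule has_gateaux_derivative_coefficientwise[OF b \<open>t > 0\<close>, where C = C,
              OF mult.commute mult.commute deriv deriv bounded bounded[OF \<open>t > 0\<close>]])
          (use C in auto)
    qed
    then show ?case
      using Suc by (subst has_nth_gateaux_derivative.simps(2)) blast
  qed
  have "has_nth_gateaux_derivative q N U (\<lambda>t k. b k * of_real (m k ^ (N - 1) * exp (m k * t)))"
    if "N \<ge> 1" for N
    using nth[of "N - 1"] that by (simp del: has_nth_gateaux_derivative.simps)
  moreover have "V t = (\<lambda>k. b k * of_real (exp (m k * t)))" if "t > 0" for t
    using that V[of t] by (auto simp: mult.commute)
  ultimately show ?thesis
    using U' by simp
qed

end
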